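(* Let $(\mathcal{N},[\cdot,\dots,\cdot],B)$ be a quadratic $n$-ary Nambu algebra and let $\rho\in Aut_S(\mathcal{N},B)$. Put $[\cdot,\dots,\cdot]_\rho=\rho\circ[\cdot,\dots,\cdot]$, $\tilde\rho=(\rho,\dots,\rho)$ ($n-1$ copies) and $B_\rho(x,y)=B(\rho(x),y)$. Then $(\mathcal{N},[\cdot,\dots,\cdot]_\rho,\tilde\rho,B,\rho)$ is a Hom-quadratic $n$-ary Hom-Nambu algebra, and $(\mathcal{N},[\cdot,\dots,\cdot]_\rho,\tilde\rho,B_\rho)$ is a quadratic $n$-ary Hom-Nambu algebra.
   Context: $\mathbb{K}$ is an algebraically closed field of characteristic zero and $n\ge 2$. An $n$-ary Hom-Nambu algebra is a triple $(\mathcal{N},[\cdot,\dots,\cdot],\tilde\alpha)$ with $\mathcal{N}$ a $\mathbb{K}$-vector space, $[\cdot,\dots,\cdot]:\mathcal{N}^n\to\mathcal{N}$ an $n$-linear map and $\tilde\alpha=(\alpha_1,\dots,\alpha_{n-1})$ linear maps $\mathcal{N}\to\mathcal{N}$ such that $$[\alpha_1(x_1),\dots,\alpha_{n-1}(x_{n-1}),[y_1,\dots,y_n]]=\sum_{i=1}^n[\alpha_1(y_1),\dots,\alpha_{i-1}(y_{i-1}),[x_1,\dots,x_{n-1},y_i],\alpha_i(y_{i+1}),\dots,\alpha_{n-1}(y_n)].$$ It is an $n$-ary Nambu algebra when all $\alpha_i=id$. $(\mathcal{N},[\cdot,\dots,\cdot],\tilde\alpha,B)$ is a quadratic $n$-ary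 Hom-Nambu algebra if $B$ is a nondegenerate symmetric bilinear form with $B([x_1,\dots,x_{n-1},y],z)+B(y,[x_1,\dots,x_{n-1},z])=0$ and $B(\alpha_i(y),z)=B(y,\alpha_i(z))$ for all $i$; when all $\alpha_i=id$ it is called a quadratic $n$-ary Nambu algebra. $(\mathcal{N},[\cdot,\dots,\cdot],\tilde\alpha,B,\beta)$ is a Hom-quadratic $n$-ary Hom-Nambu algebra if $B$ is a nondegenerate symmetric bilinear form and $\beta\in End(\mathcal{N})$ satisfies $B([x_1,\dots,x_{n-1},y],\beta(z))+B(\beta(y),[x_1,\dots,x_{n-1},z])=0$ for all elements. $Aut_S(\mathcal{N},B)$ is the set of algebra automorphisms $f$ of $\mathcal{N}$ (bijective linear maps with $f([x_1,\dots,x_n])=[f(x_1),\dots,f(x_n)]$) such that $B(f(x),y)=B(x,f(y))$ for all $x,y$. *)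

theory Defs
  imports "HOL-Computational_Algebra.Polynomial"
begin

text \<open>
  An n-ary bracket is a function on lists, used only on lists of length n; its values on
  other lists are irrelevant. The family of twisting maps is a list of length n - 1.
\<close>

definition multilinear_bracket ::
  "('k::field \<Rightarrow> 'v::ab_group_add \<Rightarrow> 'v) \<Rightarrow> nat \<Rightarrow> ('v list \<Rightarrow> 'v) \<Rightarrow> bool" where
  "multilinear_bracket scale n br \<longleftrightarrow>
     (\<forall>us vs. length us + 1 + length vs = n \<longrightarrow>
        Vector_Spaces.linear scale scale (\<lambda>x. br (us @ [x] @ vs)))"

definition apply_maps :: "('v \<Rightarrow> 'v) list \<Rightarrow> 'v list \<Rightarrow> 'v list" where
  "apply_maps \<alpha>s xs = map2 (\<lambda>\<alpha> x. \<alpha> x) \<alpha>s xs"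

text \<open>
  In the Hom-Nambu identity the positions are counted from 0: in the i-th summand the
  entries before position i carry the maps with indices below i, and the entry at position
  j + 1 > i carries the map with index j.
\<close>

locale hom_nambu_algebra = vector_space scale
  for scale :: "'k::field \<Rightarrow> 'v::ab_group_add \<Rightarrow> 'v" +
  fixes n :: nat
    and br :: "'v list \<Rightarrow> 'v"
    and \<alpha>s :: "('v \<Rightarrow> 'v) list"
  assumes multilinear: "multilinear_bracket scale n br"
    and length_maps: "length \<alpha>s = n - 1"
    and linear_maps: "\<And>\<alpha>. \<alpha> \<in> set \<alpha>s \<Longrightarrow> Vector_Spaces.linear scale scale \<alpha>"
    and hom_nambu_identity:
      "\<And>xs ys. length xs = n - 1 \<Longrightarrow> length ys = n \<Longrightarrow>
         br (apply_maps \<alpha>s xs @ [br ys]) =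
         (\<Sum>i<n. br (apply_maps (take i \<alpha>s) (take i ys) @ [br (xs @ [ys ! i])]
                     @ apply_maps (drop i \<alpha>s) (drop (Suc i) ys)))"

definition nondegenerate_symmetric_bilinear_form ::
  "('k::field \<Rightarrow> 'v::ab_group_add \<Rightarrow> 'v) \<Rightarrow> ('v \<Rightarrow> 'v \<Rightarrow> 'k) \<Rightarrow> bool" where
  "nondegenerate_symmetric_bilinear_form scale B \<longleftrightarrow>
     (\<forall>x. Vector_Spaces.linear scale (*) (\<lambda>y. B x y)) \<and>
     (\<forall>y. Vector_Spaces.linear scale (*) (\<lambda>x. B x y)) \<and>
     (\<forall>x y. B x y = B y x) \<and>
     (\<forall>x. (\<forall>y. B x y = 0) \<longrightarrow> x = 0)"

locale quadratic_hom_nambu_algebra = hom_nambu_algebra scale n br \<alpha>s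
  for scale :: "'k::field \<Rightarrow> 'v::ab_group_add \<Rightarrow> 'v"
    and n :: nat
    and br :: "'v list \<Rightarrow> 'v"
    and \<alpha>s :: "('v \<Rightarrow> 'v) list" +
  fixes B :: "'v \<Rightarrow> 'v \<Rightarrow> 'k"
  assumes form: "nondegenerate_symmetric_bilinear_form scale B"
    and invariant: "\<And>xs y z. length xs = n - 1 \<Longrightarrow>
      B (br (xs @ [y])) z + B y (br (xs @ [z])) = 0"
    and maps_symmetric: "\<And>\<alpha> y z. \<alpha> \<in> set \<alpha>s \<Longrightarrow> B (\<alpha> y) z = B y (\<alpha> z)"

abbreviation quadratic_nambu_algebra ::
  "('k::field \<Rightarrow> 'v::ab_group_add \<Rightarrow> 'v) \<Rightarrow> nat \<Rightarrow> ('v list \<Rightarrow> 'v) \<Rightarrow> ('v \<Rightarrow> 'v \<Rightarrow> 'k) \<Rightarrow> bool"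
  where
  "quadratic_nambu_algebra scale n br B \<equiv>
     quadratic_hom_nambu_algebra scale n br (replicate (n - 1) id) B"

locale hom_quadratic_hom_nambu_algebra = hom_nambu_algebra scale n br \<alpha>s
  for scale :: "'k::field \<Rightarrow> 'v::ab_group_add \<Rightarrow> 'v"
    and n :: nat
    and br :: "'v list \<Rightarrow> 'v"
    and \<alpha>s :: "('v \<Rightarrow> 'v) list" +
  fixes B :: "'v \<Rightarrow> 'v \<Rightarrow> 'k"
    and \<beta> :: "'v \<Rightarrow> 'v"
  assumes form: "nondegenerate_symmetric_bilinear_form scale B"
    and linear_twist: "Vector_Spaces.linear scale scale \<beta>"
    and hom_invariant: "\<And>xs y z. length xs = n - 1 \<Longrightarrow>
      B (br (xs @ [y])) (\<beta> z) + B (\<beta> y) (br (xs @ [z])) = 0"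

definition Aut_S ::
  "('k::field \<Rightarrow> 'v::ab_group_add \<Rightarrow> 'v) \<Rightarrow> nat \<Rightarrow> ('v list \<Rightarrow> 'v) \<Rightarrow> ('v \<Rightarrow> 'v \<Rightarrow> 'k)
     \<Rightarrow> ('v \<Rightarrow> 'v) set" where
  "Aut_S scale n br B =
     {f. Vector_Spaces.linear scale scale f \<and> bij f \<and>
         (\<forall>xs. length xs = n \<longrightarrow> f (br xs) = br (map f xs)) \<and>
         (\<forall>x y. B (f x) y = B x (f y))}"

end

(* Invariance of B and symmetry of rho together force [rho^2 x_1, ..., rho^2 x_(n-1), y] =
   [x_1, ..., x_(n-1), y]: moving rho across B and through the bracket gives
   B([x, rho y], z) = - B(rho y, [x, z]) = - B(y, [rho x, rho z]) = B([rho x, y], rho z)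
   = B([rho^2 x, rho y], z), and rho is onto. Hence B(rho [x, y], rho z) = - B(y, [x, rho^2 z]) =
   - B(y, rho^2 [x, z]) = - B(rho y, rho [x, z]), which is the invariance required both of (B, rho)
   and of B_rho. The Hom-Nambu identity for rho o [...] is rho^2 applied to the Nambu identity. *)

theory Submission
  imports Defs
begin

text \<open>\<open>map2\<close> stops at the shorter list, hence the \<open>take m\<close>. In each
  use below the list has exactly as many entries as there are maps, so the truncation is
  harmless.\<close>

lemma apply_maps_replicate:
  "apply_maps (replicate m f) xs = map f (take m xs)"
  unfolding apply_maps_def
proof (induction m arbitrary: xs)
  case (Suc m)
  then show ?case by (cases xs) auto
qed simp

text \<open>Yau's twisting principle; no form is involved. In every term of the twisted identity
  each outer entry carries one \<open>f\<close>, either as a twisting map or from the inner twisted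
  bracket, so multiplicativity applies to the whole list.\<close>

lemma hom_nambu_algebra_twist:
  assumes "n > 0"
    and nambu: "hom_nambu_algebra scale n br (replicate (n - 1) id)"
    and lin: "Vector_Spaces.linear scale scale f"
    and hom: "\<And>xs. length xs = n \<Longrightarrow> f (br xs) = br (map f xs)"
  shows "hom_nambu_algebra scale n (f \<circ> br) (replicate (n - 1) f)"
proof -
  interpret N: hom_nambu_algebra scale n br "replicate (n - 1) id" by (fact nambu)
  interpret f: Vector_Spaces.linear scale scale f by (fact lin)
  show ?thesis
  proof (intro hom_nambu_algebra.intro hom_nambu_algebra_axioms.intro N.vector_space_axioms)
    have "Vector_Spaces.linear scale scale (f \<circ> (\<lambda>x. br (us @ [x] @ vs)))"
      if "length us + 1 + length vs = n" for us vs
      using N.multilinear that lin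
      by (intro Vector_Spaces.linear_compose) (auto simp: multilinear_bracket_def)
    then show "multilinear_bracket scale n (f \<circ> br)"
      by (simp add: multilinear_bracket_def comp_def)
  next
    show "length (replicate (n - 1) f) = n - 1" by simp
  next
    fix \<alpha> assume "\<alpha> \<in> set (replicate (n - 1) f)"
    then show "Vector_Spaces.linear scale scale \<alpha>" using lin by (auto split: if_splits)
  next
    fix xs ys :: "'b list"
    assume xs: "length xs = n - 1" and ys: "length ys = n"
    let ?summand = "\<lambda>i. take i ys @ [br (xs @ [ys ! i])] @ drop (Suc i) ys"
    have nambu_identity: "br (xs @ [br ys]) = (\<Sum>i<n. br (?summand i))"
      using N.hom_nambu_identity[OF xs ys] xs ys by (simp add: apply_maps_replicate)
    have "(f \<circ> br) (apply_maps (replicate (n - 1) f) xs @ [(f \<circ> br) ys])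
        = f (f (br (xs @ [br ys])))"
      \<comment> \<open>One \<open>f\<close> is the outer factor of \<open>f \<circ> br\<close>, the
        other is pulled out of the entries.\<close>
      using xs \<open>n > 0\<close> by (simp add: apply_maps_replicate hom)
    also have "\<dots> = (\<Sum>i<n. f (f (br (?summand i))))"
      by (simp only: nambu_identity f.sum)
    also have "\<dots> = (\<Sum>i<n. (f \<circ> br) (apply_maps (take i (replicate (n - 1) f)) (take i ys)
        @ [(f \<circ> br) (xs @ [ys ! i])]
        @ apply_maps (drop i (replicate (n - 1) f)) (drop (Suc i) ys)))"
    proof (rule sum.cong)
      fix i assume "i \<in> {..<n}"
      \<comment> \<open>The second bound settles the \<open>min\<close> in the length of
        \<open>take i (replicate (n - 1) f)\<close>: exactly \<open>i\<close> maps precede the inner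
        bracket.\<close>
      then have i: "i < n" "i \<le> n - 1" by simp_all
      then have "f (br (?summand i)) = br (map f (?summand i))"
        using ys by (intro hom) simp
      with i ys show "f (f (br (?summand i))) =
          (f \<circ> br) (apply_maps (take i (replicate (n - 1) f)) (take i ys)
            @ [(f \<circ> br) (xs @ [ys ! i])]
            @ apply_maps (drop i (replicate (n - 1) f)) (drop (Suc i) ys))"
        by (simp add: apply_maps_replicate min_def)
    qed simp
    finally show "(f \<circ> br) (apply_maps (replicate (n - 1) f) xs @ [(f \<circ> br) ys]) =
        (\<Sum>i<n. (f \<circ> br) (apply_maps (take i (replicate (n - 1) f)) (take i ys)
          @ [(f \<circ> br) (xs @ [ys ! i])]
          @ apply_maps (drop i (replicate (n - 1) f)) (drop (Suc i) ys)))" .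
  qed
qed

text \<open>Nondegeneracy is applied to \<open>x - y\<close>. This allows brackets to be compared by
  pairing them with an arbitrary vector.\<close>

lemma nondegenerate_form_eqI:
  assumes form: "nondegenerate_symmetric_bilinear_form scale B"
    and eq: "\<And>z. B x z = B y z"
  shows "x = y"
proof -
  have "B (x - y) z = 0" for z
  proof -
    interpret Vector_Spaces.linear scale "(*)" "\<lambda>x. B x z"
      using form by (simp add: nondegenerate_symmetric_bilinear_form_def)
    show ?thesis by (simp add: diff eq)
  qed
  then have "x - y = 0"
    using form unfolding nondegenerate_symmetric_bilinear_form_def by blast
  then show ?thesis by simp
qed

text \<open>Self-adjointness of \<open>f\<close> makes the new form symmetric, and injectivity of
  \<open>f\<close> transfers nondegeneracy from \<open>B\<close>.\<close>

lemma nondegenerate_symmetric_bilinear_form_twist: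
  assumes form: "nondegenerate_symmetric_bilinear_form scale B"
    and lin: "Vector_Spaces.linear scale scale f"
    and "inj f"
    and sym: "\<And>x y. B (f x) y = B x (f y)"
  shows "nondegenerate_symmetric_bilinear_form scale (\<lambda>x y. B (f x) y)"
proof -
  have B: "Vector_Spaces.linear scale (*) (\<lambda>y. B x y)"
    "Vector_Spaces.linear scale (*) (\<lambda>x. B x y)"
    "B x y = B y x" "(\<And>y. B x y = 0) \<Longrightarrow> x = 0" for x y
    using form by (auto simp: nondegenerate_symmetric_bilinear_form_def)
  interpret f: Vector_Spaces.linear scale scale f by (fact lin)
  have "Vector_Spaces.linear scale (*) (\<lambda>x. B (f x) y)" for y
    using Vector_Spaces.linear_compose[OF lin B(2)] by (simp add: comp_def)
  moreover have "B (f x) y = B (f y) x" for x y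
    by (metis B(3) sym)
  moreover have "x = 0" if "\<And>y. B (f x) y = 0" for x
    using B(4)[OF that] \<open>inj f\<close> by (metis f.zero injD)
  ultimately show ?thesis
    using B(1) by (simp add: nondegenerate_symmetric_bilinear_form_def)
qed

context
  fixes scale :: "'k::field \<Rightarrow> 'v::ab_group_add \<Rightarrow> 'v"
    and n :: nat
    and br :: "'v list \<Rightarrow> 'v"
    and B :: "'v \<Rightarrow> 'v \<Rightarrow> 'k"
    and \<rho> :: "'v \<Rightarrow> 'v"
  assumes n_pos: "n > 0"
    and nambu: "quadratic_nambu_algebra scale n br B"
    and aut: "\<rho> \<in> Aut_S scale n br B"
begin

interpretation Q: quadratic_hom_nambu_algebra scale n br "replicate (n - 1) id" B
  by (fact nambu)

lemma
  shows Aut_S_linear: "Vector_Spaces.linear scale scale \<rho>"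
    and Aut_S_bij: "bij \<rho>"
    and Aut_S_hom: "length xs = n \<Longrightarrow> \<rho> (br xs) = br (map \<rho> xs)"
    and Aut_S_symmetric: "B (\<rho> x) y = B x (\<rho> y)"
  using aut by (auto simp: Aut_S_def)

text \<open>Invariance singles out the last argument, so multiplicativity is put in the same shape;
  \<open>n_pos\<close> gives (n - 1) + 1 = n under truncated subtraction.\<close>

lemma Aut_S_hom_snoc: "length xs = n - 1 \<Longrightarrow> \<rho> (br (xs @ [y])) = br (map \<rho> xs @ [\<rho> y])"
  using n_pos by (simp add: Aut_S_hom)

lemma invariant_minus:
  "length xs = n - 1 \<Longrightarrow> B (br (xs @ [y])) z = - B y (br (xs @ [z]))"
  using Q.invariant by (simp add: eq_neg_iff_add_eq_0)

lemma Aut_S_square_acts_trivially: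
  assumes xs: "length xs = n - 1"
  shows "br (map \<rho> (map \<rho> xs) @ [y]) = br (xs @ [y])"
proof -
  \<comment> \<open>The chain takes this \<rho> off \<open>w\<close>, across \<open>B\<close>, and
    later brings one back from \<rho> \<open>z\<close>. Each of the two passages through a bracket
    puts one \<rho> on every entry of \<open>xs\<close>.\<close>
  obtain w where y: "y = \<rho> w" using Aut_S_bij by (meson bij_pointE)
  have "B (br (xs @ [\<rho> w])) z = B (br (map \<rho> (map \<rho> xs) @ [\<rho> w])) z" for z
  proof -
    have "B (br (xs @ [\<rho> w])) z = - B w (br (map \<rho> xs @ [\<rho> z]))"
      using xs by (simp add: invariant_minus Aut_S_symmetric Aut_S_hom_snoc)
    also have "\<dots> = B (br (map \<rho> xs @ [w])) (\<rho> z)"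
      using xs by (simp add: invariant_minus)
    also have "\<dots> = B (\<rho> (br (map \<rho> xs @ [w]))) z"
      by (simp only: Aut_S_symmetric)
    also have "\<dots> = B (br (map \<rho> (map \<rho> xs) @ [\<rho> w])) z"
      using xs by (simp only: Aut_S_hom_snoc length_map)
    finally show ?thesis .
  qed
  then show ?thesis
    unfolding y by (intro nondegenerate_form_eqI[OF Q.form]) simp
qed

lemma Aut_S_twisted_invariant:
  assumes xs: "length xs = n - 1"
  shows "B (\<rho> (br (xs @ [y]))) (\<rho> z) + B (\<rho> y) (\<rho> (br (xs @ [z]))) = 0"
proof -
  have "B (\<rho> (br (xs @ [y]))) (\<rho> z) = - B y (br (xs @ [\<rho> (\<rho> z)]))"
    using xs by (simp only: Aut_S_symmetric invariant_minus)
  \<comment> \<open>Inserting \<rho> twice on \<open>xs\<close> leaves the bracket unchanged, and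
    now all its entries carry two copies, which can be pulled out in front.\<close>
  also have "\<dots> = - B y (br (map \<rho> (map \<rho> xs) @ [\<rho> (\<rho> z)]))"
    by (simp only: Aut_S_square_acts_trivially[OF xs])
  also have "\<dots> = - B (\<rho> y) (\<rho> (br (xs @ [z])))"
    using xs by (simp only: Aut_S_hom_snoc length_map Aut_S_symmetric)
  finally show ?thesis by simp
qed

lemma hom_nambu_algebra_Aut_S_twist:
  "hom_nambu_algebra scale n (\<rho> \<circ> br) (replicate (n - 1) \<rho>)"
  using n_pos Q.hom_nambu_algebra_axioms Aut_S_linear Aut_S_hom by (rule hom_nambu_algebra_twist)

lemma hom_quadratic_twist:
  "hom_quadratic_hom_nambu_algebra scale n (\<rho> \<circ> br) (replicate (n - 1) \<rho>) B \<rho>"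
  by (intro hom_quadratic_hom_nambu_algebra.intro hom_nambu_algebra_Aut_S_twist
      hom_quadratic_hom_nambu_algebra_axioms.intro Q.form Aut_S_linear)
    (simp add: Aut_S_twisted_invariant)

lemma quadratic_twist:
  "quadratic_hom_nambu_algebra scale n (\<rho> \<circ> br) (replicate (n - 1) \<rho>) (\<lambda>x y. B (\<rho> x) y)"
proof (intro quadratic_hom_nambu_algebra.intro hom_nambu_algebra_Aut_S_twist
    quadratic_hom_nambu_algebra_axioms.intro)
  show "nondegenerate_symmetric_bilinear_form scale (\<lambda>x y. B (\<rho> x) y)"
    using Q.form Aut_S_linear bij_is_inj[OF Aut_S_bij] Aut_S_symmetric
    by (rule nondegenerate_symmetric_bilinear_form_twist)
next
  fix xs y z assume "length (xs :: 'v list) = n - 1"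
  \<comment> \<open>The first bracket below carries two copies of \<rho>, one from the new form and
    one from the new bracket; symmetry moves one of them onto \<open>z\<close>.\<close>
  from Aut_S_twisted_invariant[OF this]
  show "B (\<rho> ((\<rho> \<circ> br) (xs @ [y]))) z + B (\<rho> y) ((\<rho> \<circ> br) (xs @ [z])) = 0"
    by (simp add: Aut_S_symmetric)
next
  fix \<alpha> y z assume "\<alpha> \<in> set (replicate (n - 1) \<rho>)"
  then show "B (\<rho> (\<alpha> y)) z = B (\<rho> y) (\<alpha> z)"
    by (auto simp: Aut_S_symmetric split: if_splits)
qed

end

theorem proposition5p1:
  fixes scale :: "'k::{alg_closed_field, field_char_0} \<Rightarrow> 'v::ab_group_add \<Rightarrow> 'v"
    and n :: nat
    and br :: "'v list \<Rightarrow> 'v"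
    and B :: "'v \<Rightarrow> 'v \<Rightarrow> 'k"
    and \<rho> :: "'v \<Rightarrow> 'v"
  assumes "n \<ge> 2"
    and "quadratic_nambu_algebra scale n br B"
    and "\<rho> \<in> Aut_S scale n br B"
  shows "hom_quadratic_hom_nambu_algebra scale n (\<rho> \<circ> br) (replicate (n - 1) \<rho>) B \<rho> \<and>
         quadratic_hom_nambu_algebra scale n (\<rho> \<circ> br) (replicate (n - 1) \<rho>) (\<lambda>x y. B (\<rho> x) y)"
  using assms by (intro conjI hom_quadratic_twist quadratic_twist) simp_all

end
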